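(* Let $K\ge2$, $0<v_1<\dots<v_K$, let $x^*$ be a probability distribution on $\{v_1,\dots,v_K\}$, and let $\beta\in[0,1)$. Let $\mathcal P\subset\mathbb R^{K^2}$ be the convex polytope of all $(z(i,j))_{i,j=1}^K$ satisfying (a) $z(i,1)\ge\cdots\ge z(i,K)\ge0$ for all $i\in[K]$; (b) $z(i,i)v_i-z(i,j)v_j\ \ge\ \frac{\beta}{K(1-\beta)}\,z(i,1)\big((K+1-j)v_j-(K+1-i)v_i\big)$ for all $i,j\in[K]$; (c) $\sum_{i=1}^K z(i,j)=\sum_{k=j}^K x^*(v_k)$ for all $j\in[K]$. Then the set $\mathcal S'$ (defined in the context) is the image of $\mathcal P$ under a linear map $\mathbb R^{K^2}\to\mathbb R^2$, namely $$\mathcal S'=\Big\{\Big[\sum_{i=1}^{K-1}\sum_{j=i+1}^K(v_j-v_{j-1})z(i,j),\ \sum_{i=1}^K v_i z(i,i)\Big]^\top:\ z\in\mathcal P\Big\}.$$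
   Context: $[K]=\{1,\dots,K\}$; $\mathcal V=\{v_1,\dots,v_K\}$; a market is a probability distribution $x$ on $\mathcal V$; $\mathcal X$ is the simplex of all markets, $\mathrm{Unif}(\mathcal X)$ the uniform distribution on it. For a price $p\ge0$ and market $x$: $\mathcal U_p(p,x)=p\sum_k x(v_k)\mathbf 1(p\le v_k)$ and $\mathcal U_c(p,x)=\sum_k x(v_k)(v_k-p)\mathbf 1(p\le v_k)$. For an observed market $\hat x$, the producer's posterior is $\pi_\beta(\cdot|\hat x)=(1-\beta)\delta_{\hat x}+\beta\,\mathrm{Unif}(\mathcal X)$, and $\mathcal U_p(p|\hat x)=\mathbb E_{x\sim\pi_\beta(\cdot|\hat x)}[\mathcal U_p(p,x)]$. For $i\in[K]$ let $$\mathcal X_i^\beta=\{\hat x\in\mathcal X:\ \mathcal U_p(v_i|\hat x)\ge\mathcal U_p(v_j|\hat x)\ \text{for all } j\in[K]\}.$$ $\mathcal S'$ is the set of all vectors $\big[\sum_{k=1}^K\gamma_k\,\mathcal U_c(v_k,x_k),\ \sum_{k=1}^K\gamma_k\,\mathcal U_p(v_k,x_k)\big]^\top$ where $\gamma_k\in[0,1]$, $\sum_k\gamma_k=1$, $\sum_k\gamma_kx_k=x^*$, and $x_k\in\mathcal X_k^\beta$ for every $k$ with $\gamma_k>0$ (terms with $\gamma_k=0$ are dropped, so some $\mathcal X_k^\beta$ may be empty). *)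

theory Defs
  imports "HOL-Probability.Probability" "HOL-Library.Function_Algebras"
begin

(* The values are v 1, ..., v K.  A market is a nonnegative function on the set of values with
   total mass 1; extensionality makes it a point of the product space over the set of values. *)

definition vals :: "nat \<Rightarrow> (nat \<Rightarrow> real) \<Rightarrow> real set" where
  "vals K v = v ` {1..K}"

definition markets :: "nat \<Rightarrow> (nat \<Rightarrow> real) \<Rightarrow> (real \<Rightarrow> real) set" where
  "markets K v = {x \<in> vals K v \<rightarrow>\<^sub>E {0..}. (\<Sum>w\<in>vals K v. x w) = 1}"

definition market_space :: "nat \<Rightarrow> (nat \<Rightarrow> real) \<Rightarrow> (real \<Rightarrow> real) measure" where
  "market_space K v = PiM (vals K v) (\<lambda>_. borel)"

(* The uniform distribution on the simplex: normalised Lebesgue measure in the K - 1 coordinates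
   other than x (v K), transported to the simplex by the affine chart x (v K) = 1 - (sum of the
   other coordinates).  Which coordinate is eliminated is immaterial, since the transition maps
   between two such charts are affine with determinant of absolute value 1. *)

definition corner_simplex :: "nat \<Rightarrow> (nat \<Rightarrow> real) \<Rightarrow> (real \<Rightarrow> real) set" where
  "corner_simplex K v =
     {y \<in> (vals K v - {v K}) \<rightarrow>\<^sub>E {0..}. (\<Sum>w\<in>vals K v - {v K}. y w) \<le> 1}"

definition unif_markets :: "nat \<Rightarrow> (nat \<Rightarrow> real) \<Rightarrow> (real \<Rightarrow> real) measure" where
  "unif_markets K v =
     distr (uniform_measure (PiM (vals K v - {v K}) (\<lambda>_. lborel)) (corner_simplex K v))
       (market_space K v)
       (\<lambda>y. y(v K := 1 - (\<Sum>w\<in>vals K v - {v K}. y w)))"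

(* The mixture (1 - \<beta>) \<cdot> (point mass at xh) + \<beta> \<cdot> (uniform distribution); see emeasure_posterior. *)
definition posterior ::
  "nat \<Rightarrow> (nat \<Rightarrow> real) \<Rightarrow> real \<Rightarrow> (real \<Rightarrow> real) \<Rightarrow> (real \<Rightarrow> real) measure" where
  "posterior K v \<beta> xh =
     measure_pmf (bernoulli_pmf \<beta>) \<bind>
       (\<lambda>b. if b then unif_markets K v else return (market_space K v) xh)"

definition producer_util :: "nat \<Rightarrow> (nat \<Rightarrow> real) \<Rightarrow> real \<Rightarrow> (real \<Rightarrow> real) \<Rightarrow> real" where
  "producer_util K v p x = p * (\<Sum>k=1..K. x (v k) * of_bool (p \<le> v k))"

definition consumer_util :: "nat \<Rightarrow> (nat \<Rightarrow> real) \<Rightarrow> real \<Rightarrow> (real \<Rightarrow> real) \<Rightarrow> real" where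
  "consumer_util K v p x = (\<Sum>k=1..K. x (v k) * (v k - p) * of_bool (p \<le> v k))"

definition expected_producer_util ::
  "nat \<Rightarrow> (nat \<Rightarrow> real) \<Rightarrow> real \<Rightarrow> real \<Rightarrow> (real \<Rightarrow> real) \<Rightarrow> real" where
  "expected_producer_util K v \<beta> p xh = (\<integral>x. producer_util K v p x \<partial>posterior K v \<beta> xh)"

definition price_region ::
  "nat \<Rightarrow> (nat \<Rightarrow> real) \<Rightarrow> real \<Rightarrow> nat \<Rightarrow> (real \<Rightarrow> real) set" where
  "price_region K v \<beta> i =
     {xh \<in> markets K v. \<forall>j\<in>{1..K}.
        expected_producer_util K v \<beta> (v i) xh \<ge> expected_producer_util K v \<beta> (v j) xh}"

(* Where \<gamma> k = 0 the market x k is unconstrained; it contributes nothing to any of the sums. *)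
definition surplus_set ::
  "nat \<Rightarrow> (nat \<Rightarrow> real) \<Rightarrow> real \<Rightarrow> (real \<Rightarrow> real) \<Rightarrow> (real ^ 2) set" where
  "surplus_set K v \<beta> xs =
     {vector [\<Sum>k=1..K. \<gamma> k * consumer_util K v (v k) (x k),
              \<Sum>k=1..K. \<gamma> k * producer_util K v (v k) (x k)]
      |(\<gamma> :: nat \<Rightarrow> real) (x :: nat \<Rightarrow> real \<Rightarrow> real).
        (\<forall>k\<in>{1..K}. \<gamma> k \<in> {0..1}) \<and> (\<Sum>k=1..K. \<gamma> k) = 1 \<and>
        (\<forall>w\<in>vals K v. (\<Sum>k=1..K. \<gamma> k * x k w) = xs w) \<and>
        (\<forall>k\<in>{1..K}. \<gamma> k > 0 \<longrightarrow> x k \<in> price_region K v \<beta> k)}"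

(* The space of real K x K arrays, as the functions vanishing off {1..K} x {1..K}. *)
definition arrays :: "nat \<Rightarrow> (nat \<times> nat \<Rightarrow> real) set" where
  "arrays K = {z. \<forall>ij. ij \<notin> {1..K} \<times> {1..K} \<longrightarrow> z ij = 0}"

definition surplus_polytope ::
  "nat \<Rightarrow> (nat \<Rightarrow> real) \<Rightarrow> real \<Rightarrow> (real \<Rightarrow> real) \<Rightarrow> (nat \<times> nat \<Rightarrow> real) set" where
  "surplus_polytope K v \<beta> xs =
     {z \<in> arrays K.
        (\<forall>i\<in>{1..K}. (\<forall>j\<in>{1..<K}. z (i, j) \<ge> z (i, j + 1)) \<and> z (i, K) \<ge> 0) \<and>
        (\<forall>i\<in>{1..K}. \<forall>j\<in>{1..K}.
           z (i, i) * v i - z (i, j) * v j \<ge>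
           \<beta> / (real K * (1 - \<beta>)) * z (i, 1) *
             ((real K + 1 - real j) * v j - (real K + 1 - real i) * v i)) \<and>
        (\<forall>j\<in>{1..K}. (\<Sum>i=1..K. z (i, j)) = (\<Sum>k=j..K. xs (v k)))}"

definition surplus_map :: "nat \<Rightarrow> (nat \<Rightarrow> real) \<Rightarrow> (nat \<times> nat \<Rightarrow> real) \<Rightarrow> real ^ 2" where
  "surplus_map K v z =
     vector [\<Sum>i=1..K - 1. \<Sum>j=i + 1..K. (v j - v (j - 1)) * z (i, j),
             \<Sum>i=1..K. v i * z (i, i)]"


lemma finite_vals [simp]: "finite (vals K v)"
  by (simp add: vals_def)

lemma sets_unif_markets [simp]: "sets (unif_markets K v) = sets (market_space K v)"
  by (simp add: unif_markets_def)

lemma space_market_space: "space (market_space K v) = extensional (vals K v)"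
  by (simp add: market_space_def space_PiM PiE_def)

lemma corner_simplex_sets:
  "corner_simplex K v \<in> sets (PiM (vals K v - {v K}) (\<lambda>_. lborel))"
proof -
  let ?I = "vals K v - {v K}"
  let ?M = "PiM ?I (\<lambda>_. lborel :: real measure)"
  have *: "corner_simplex K v =
      {y \<in> space ?M. (\<forall>w\<in>?I. 0 \<le> y w) \<and> (\<Sum>w\<in>?I. y w) \<le> 1}"
    by (auto simp: corner_simplex_def space_PiM PiE_def Pi_def)
  have "\<And>w. w \<in> ?I \<Longrightarrow> (\<lambda>y. y w) \<in> borel_measurable ?M"
    using measurable_component_singleton[of _ ?I "\<lambda>_. lborel :: real measure"] by simp
  then have "(\<lambda>y. \<Sum>w\<in>?I. y w) \<in> borel_measurable ?M"
    and "\<And>w. w \<in> ?I \<Longrightarrow> {y \<in> space ?M. 0 \<le> y w} \<in> sets ?M"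
    by (auto intro!: borel_measurable_sum borel_measurable_le)
  then show ?thesis
    unfolding * by (intro sets.sets_Collect_conj sets.sets_Collect_finite_All borel_measurable_le) auto
qed

lemma emeasure_corner_simplex:
  "emeasure (PiM (vals K v - {v K}) (\<lambda>_. lborel)) (corner_simplex K v) \<notin> {0, \<infinity>}"
proof -
  let ?I = "vals K v - {v K}"
  let ?M = "PiM ?I (\<lambda>_. lborel :: real measure)"
  interpret product_sigma_finite "\<lambda>_. lborel :: real measure" by standard
  define n where "n = real (card ?I) + 1"
  have n: "n > 0" by (simp add: n_def)
  have "PiE ?I (\<lambda>_. {0..1/n}) \<subseteq> corner_simplex K v"
  proof
    fix y assume y: "y \<in> PiE ?I (\<lambda>_. {0..1/n})"
    have "(\<Sum>w\<in>?I. y w) \<le> (\<Sum>w\<in>?I. 1/n)" using y by (intro sum_mono) (auto simp: PiE_def Pi_def)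
    also have "\<dots> \<le> 1" using n by (simp add: n_def)
    finally show "y \<in> corner_simplex K v" using y
      by (auto simp: corner_simplex_def PiE_def Pi_def)
  qed
  then have "emeasure ?M (PiE ?I (\<lambda>_. {0..1/n})) \<le> emeasure ?M (corner_simplex K v)"
    by (intro emeasure_mono corner_simplex_sets)
  moreover have "emeasure ?M (PiE ?I (\<lambda>_. {0..1/n})) = (\<Prod>w\<in>?I. ennreal (1/n))"
    using n by (subst emeasure_PiM) auto
  moreover have "ennreal (1/n) \<noteq> 0" using n by (simp add: ennreal_eq_0_iff)
  then have "(\<Prod>w\<in>?I. ennreal (1/n)) \<noteq> 0" by (auto simp del: prod_constant)
  ultimately have 1: "emeasure ?M (corner_simplex K v) \<noteq> 0"
    by (metis le_zero_eq)
  have "corner_simplex K v \<subseteq> PiE ?I (\<lambda>_. {0..1})"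
  proof
    fix y assume y: "y \<in> corner_simplex K v"
    have "y w \<le> 1" if "w \<in> ?I" for w
    proof -
      have "y w \<le> (\<Sum>w\<in>?I. y w)" using y that
        by (intro member_le_sum) (auto simp: corner_simplex_def PiE_def Pi_def)
      then show ?thesis using y by (simp add: corner_simplex_def)
    qed
    then show "y \<in> PiE ?I (\<lambda>_. {0..1})" using y
      by (auto simp: corner_simplex_def PiE_def Pi_def)
  qed
  then have "emeasure ?M (corner_simplex K v) \<le> emeasure ?M (PiE ?I (\<lambda>_. {0..1}))"
    by (intro emeasure_mono sets_PiM_I_finite) auto
  also have "\<dots> = 1" by (subst emeasure_PiM) auto
  finally have "emeasure ?M (corner_simplex K v) \<noteq> \<infinity>" by (auto simp: top_unique)
  with 1 show ?thesis by simp
qed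

lemma chart_measurable:
  assumes "K \<ge> 1"
  shows "(\<lambda>y. y(v K := 1 - (\<Sum>w\<in>vals K v - {v K}. y w)))
    \<in> PiM (vals K v - {v K}) (\<lambda>_. lborel) \<rightarrow>\<^sub>M market_space K v"
proof -
  let ?I = "vals K v - {v K}"
  have ins: "vals K v = insert (v K) ?I" using assms by (auto simp: vals_def)
  have comp: "\<And>w. w \<in> ?I \<Longrightarrow> (\<lambda>y. y w) \<in> borel_measurable (PiM ?I (\<lambda>_. lborel :: real measure))"
    using measurable_component_singleton[of _ ?I "\<lambda>_. lborel :: real measure"] by simp
  show ?thesis
    unfolding market_space_def
  proof (rule measurable_PiM_single')
    fix w assume w: "w \<in> vals K v"
    have "(\<lambda>y. \<Sum>w\<in>?I. y w) \<in> borel_measurable (PiM ?I (\<lambda>_. lborel :: real measure))"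
      by (intro borel_measurable_sum comp)
    then show "(\<lambda>y. (y(v K := 1 - (\<Sum>w\<in>?I. y w))) w)
        \<in> borel_measurable (PiM ?I (\<lambda>_. lborel :: real measure))"
      using w comp by (cases "w = v K") auto
  next
    show "(\<lambda>y. y(v K := 1 - (\<Sum>w\<in>?I. y w)))
        \<in> space (PiM ?I (\<lambda>_. lborel :: real measure)) \<rightarrow> (\<Pi>\<^sub>E i\<in>vals K v. space borel)"
      using ins by (auto simp: space_PiM PiE_def extensional_def)
  qed
qed

lemma prob_space_unif_markets:
  assumes "K \<ge> 1"
  shows "prob_space (unif_markets K v)"
  unfolding unif_markets_def
proof (rule prob_space.prob_space_distr)
  show "prob_space (uniform_measure (PiM (vals K v - {v K}) (\<lambda>_. lborel)) (corner_simplex K v))"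
    using emeasure_corner_simplex by (intro prob_space_uniform_measure) auto
qed (use chart_measurable[OF assms] in \<open>simp add: measurable_def\<close>)

lemma emeasure_posterior:
  assumes "K \<ge> 1" "0 \<le> \<beta>" "\<beta> \<le> 1" "xh \<in> markets K v" "A \<in> sets (market_space K v)"
  shows "emeasure (posterior K v \<beta> xh) A =
    ennreal (1 - \<beta>) * indicator A xh + ennreal \<beta> * emeasure (unif_markets K v) A"
proof -
  have xh: "xh \<in> space (market_space K v)"
    using assms(4) by (simp add: markets_def space_market_space PiE_def)
  have "emeasure (posterior K v \<beta> xh) A =
      (\<integral>\<^sup>+b. emeasure (if b then unif_markets K v else return (market_space K v) xh) A
        \<partial>measure_pmf (bernoulli_pmf \<beta>))"
    unfolding posterior_def
  proof (rule emeasure_bind)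
    show "(\<lambda>b. if b then unif_markets K v else return (market_space K v) xh)
        \<in> measure_pmf (bernoulli_pmf \<beta>) \<rightarrow>\<^sub>M subprob_algebra (market_space K v)"
      using prob_space_unif_markets[OF assms(1)] prob_space_return[OF xh]
      by (auto simp: measurable_def space_subprob_algebra prob_space_imp_subprob_space)
  qed (use assms in auto)
  also have "\<dots> = ennreal \<beta> * emeasure (unif_markets K v) A + ennreal (1 - \<beta>) * indicator A xh"
    using assms by (subst nn_integral_measure_pmf_support[where A = UNIV])
      (auto simp: UNIV_bool mult.commute)
  finally show ?thesis by (simp add: add.commute)
qed

end

(* By symmetry every coordinate has mean 1/K under the uniform distribution on the simplex, so the
   expected utility of the price v_i after observing x is v_i ((1-beta) G_x(i) + beta (K+1-i)/K) with
   G_x(i) the mass of the values v_i, ..., v_K.  Membership in the i-th price region is therefore a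
   system of linear inequalities in G_x.  Put z(i,j) = gamma_i G_{x_i}(j): then gamma_i = z(i,1), the
   price constraints multiplied by gamma_i become (b), and both surpluses are linear in z, the
   consumers' one by summation by parts.  Conversely x_i is recovered from z as the normalised
   differences of the i-th row, and gamma_i = 0 forces that row to vanish by (a). *)

theory Submission
  imports Defs
begin

section \<open>The mean of the uniform distribution on the simplex\<close>

text \<open>Replacing coordinate \<open>w\<close> by \<open>c\<close> minus the sum of all
  coordinates is an affine involution of determinant -1, so it preserves Lebesgue measure. By
  Tonelli it suffices to integrate over \<open>w\<close> first: with the other coordinates fixed,
  the map is a reflection of the line.\<close>

lemma nn_integral_PiM_reflect:
  fixes f :: "('a \<Rightarrow> real) \<Rightarrow> ennreal"
  assumes "finite I" "w \<in> I" and f: "f \<in> borel_measurable (PiM I (\<lambda>_. lborel))"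
  shows "(\<integral>\<^sup>+y. f (y(w := c - (\<Sum>u\<in>I. y u))) \<partial>PiM I (\<lambda>_. lborel)) = (\<integral>\<^sup>+y. f y \<partial>PiM I (\<lambda>_. lborel))"
proof -
  interpret product_sigma_finite "\<lambda>_. lborel :: real measure" by standard
  define J where "J = I - {w}"
  have I: "I = insert w J" and J: "finite J" "w \<notin> J"
    using assms by (auto simp: J_def)
  let ?P = "PiM (insert w J) (\<lambda>_. lborel :: real measure)"
  have f': "f \<in> borel_measurable ?P" using f I by simp
  have comp: "(\<lambda>y. y u) \<in> borel_measurable ?P" if "u \<in> insert w J" for u
    using measurable_component_singleton[OF that, of "\<lambda>_. lborel :: real measure"] by simp
  have upd: "(\<lambda>y. y(w := c - (\<Sum>u\<in>insert w J. y u))) \<in> ?P \<rightarrow>\<^sub>M ?P"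
  proof (rule measurable_PiM_single')
    fix u assume u: "u \<in> insert w J"
    have "(\<lambda>y. \<Sum>u\<in>insert w J. y u) \<in> borel_measurable ?P"
      by (intro borel_measurable_sum comp)
    then show "(\<lambda>y. (y(w := c - (\<Sum>u\<in>insert w J. y u))) u) \<in> ?P \<rightarrow>\<^sub>M lborel"
      using u comp by (cases "u = w") auto
  qed (auto simp: space_PiM PiE_def extensional_def)
  have inner: "(\<integral>\<^sup>+t. f (x(w := c - (t + (\<Sum>u\<in>J. x u)))) \<partial>lborel) = (\<integral>\<^sup>+t. f (x(w := t)) \<partial>lborel)"
    if "x \<in> space (PiM J (\<lambda>_. lborel :: real measure))" for x
  proof -
    have "(\<lambda>t. x(w := t)) \<in> lborel \<rightarrow>\<^sub>M ?P"
      using that J by (intro measurable_fun_upd[where J = J]) auto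
    from measurable_compose[OF this f'] have m: "(\<lambda>t. f (x(w := t))) \<in> borel_measurable borel"
      by simp
    show ?thesis
      \<comment> \<open>The slope is -1, so the substitution brings in the factor 1.\<close>
      using nn_integral_real_affine[OF m, of "-1" "c - (\<Sum>u\<in>J. x u)"]
      by (simp add: algebra_simps)
  qed
  have "(\<integral>\<^sup>+y. f (y(w := c - (\<Sum>u\<in>insert w J. y u))) \<partial>?P) =
      (\<integral>\<^sup>+x. (\<integral>\<^sup>+t. f (x(w := c - (t + (\<Sum>u\<in>J. x u)))) \<partial>lborel) \<partial>PiM J (\<lambda>_. lborel))"
  proof (subst product_nn_integral_insert[OF J])
    have "(\<Sum>u\<in>J. (x(w := t)) u) = (\<Sum>u\<in>J. x u)" for x :: "'a \<Rightarrow> real" and t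
      using J by (intro sum.cong) auto
    then show "(\<integral>\<^sup>+x. \<integral>\<^sup>+t. f ((x(w := t))(w := c - sum (x(w := t)) (insert w J))) \<partial>lborel \<partial>PiM J (\<lambda>_. lborel)) =
        (\<integral>\<^sup>+x. (\<integral>\<^sup>+t. f (x(w := c - (t + (\<Sum>u\<in>J. x u)))) \<partial>lborel) \<partial>PiM J (\<lambda>_. lborel))"
      using J by simp
  qed (use measurable_compose[OF upd f'] in simp)
  also have "\<dots> = (\<integral>\<^sup>+x. (\<integral>\<^sup>+t. f (x(w := t)) \<partial>lborel) \<partial>PiM J (\<lambda>_. lborel))"
    by (intro nn_integral_cong inner)
  also have "\<dots> = (\<integral>\<^sup>+y. f y \<partial>?P)"
    by (rule product_nn_integral_insert[OF J f', symmetric])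
  finally show ?thesis using I by simp
qed

lemma card_vals:
  assumes "strict_mono_on {1..K} v"
  shows "card (vals K v) = K"
  using card_image[OF strict_mono_on_imp_inj_on[OF assms]] by (simp add: vals_def)

lemma measurable_market_coordinate:
  assumes "w \<in> vals K v"
  shows "(\<lambda>x. x w) \<in> borel_measurable (market_space K v)"
  unfolding market_space_def
  using measurable_component_singleton[OF assms, of "\<lambda>_. borel :: real measure"] by simp

text \<open>In the chart \<open>g\<close>, let \<open>a u\<close> be the integral of coordinate
  \<open>u\<close> over the corner simplex \<open>C\<close>, before normalisation. All
  \<open>a u\<close> agree by symmetry, and the coordinates add up to 1 pointwise on
  \<open>C\<close>, so \<open>K\<close> times \<open>a w\<close> is the volume of
  \<open>C\<close>.\<close>

lemma nn_integral_unif_markets_coordinate: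
  assumes K: "K \<ge> 1" and mono: "strict_mono_on {1..K} v" and w: "w \<in> vals K v"
  shows "(\<integral>\<^sup>+x. ennreal (x w) \<partial>unif_markets K v) = ennreal (1 / K)"
proof -
  define I where "I = vals K v - {v K}"
  define M where "M = PiM I (\<lambda>_. lborel :: real measure)"
  define C where "C = corner_simplex K v"
  define g where "g y = y(v K := 1 - (\<Sum>u\<in>I. y u))" for y :: "real \<Rightarrow> real"
  define a where "a u = (\<integral>\<^sup>+y. ennreal (g y u) * indicator C y \<partial>M)" for u
  have vals: "vals K v = insert (v K) I" and I: "finite I" "v K \<notin> I"
    using K by (auto simp: I_def vals_def)
  have C: "C \<in> sets M" and C0: "emeasure M C \<noteq> 0" "emeasure M C \<noteq> \<infinity>"
    using corner_simplex_sets[of K v] emeasure_corner_simplex[of K v]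
    by (auto simp: C_def M_def I_def)
  have gM: "g \<in> M \<rightarrow>\<^sub>M market_space K v"
    using chart_measurable[OF K, of v] by (simp add: g_def[abs_def] M_def I_def)
  have gu: "(\<lambda>y. g y u) \<in> borel_measurable M" if "u \<in> vals K v" for u
    using measurable_compose[OF gM measurable_market_coordinate[OF that]] .
  have C_iff: "y \<in> C \<longleftrightarrow> (\<forall>u\<in>I. 0 \<le> y u) \<and> (\<Sum>u\<in>I. y u) \<le> 1" if "y \<in> space M" for y
    using that by (auto simp: C_def corner_simplex_def I_def M_def space_PiM PiE_def Pi_def)
  txt \<open>The reflection exchanging the coordinate \<open>u\<close> with the eliminated coordinate \<open>v K\<close>
    preserves both the Lebesgue measure and the simplex.\<close>
  have a_eq: "a u = a (v K)" if u: "u \<in> I" for u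
  proof -
    have uK: "u \<noteq> v K" using u I by auto
    have "a u = (\<integral>\<^sup>+y. ennreal (g (y(u := 1 - (\<Sum>u\<in>I. y u))) u) * indicator C (y(u := 1 - (\<Sum>u\<in>I. y u))) \<partial>M)"
      unfolding a_def M_def
      using gu[of u] C u vals I
      by (intro nn_integral_PiM_reflect[symmetric]) (auto simp: M_def[symmetric])
    also have "\<dots> = a (v K)"
      unfolding a_def
    proof (rule nn_integral_cong)
      fix y assume y: "y \<in> space M"
      let ?y = "y(u := 1 - (\<Sum>u\<in>I. y u))"
      have y': "?y \<in> space M" using y u by (auto simp: M_def space_PiM PiE_def extensional_def)
      have S: "(\<Sum>u\<in>I. h u) = h u + (\<Sum>u\<in>I-{u}. h u)" for h :: "real \<Rightarrow> real"
        using u I by (simp add: sum.remove)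
      have S': "(\<Sum>u\<in>I. ?y u) = 1 - y u" using S[of y] by (simp add: S)
      \<comment> \<open>The reflected coordinate is 1 minus the old sum, and the new sum is 1 minus
        \<open>y u\<close>. Hence the constraints \<open>0 \<le> y u\<close> and "the sum is at most
        1" trade places.\<close>
      have "?y \<in> C \<longleftrightarrow> y \<in> C"
        unfolding C_iff[OF y] C_iff[OF y'] S' using u by auto
      then show "ennreal (g ?y u) * indicator C ?y = ennreal (g y (v K)) * indicator C y"
        using uK by (simp add: g_def indicator_def)
    qed
    finally show ?thesis .
  qed
  have "(\<Sum>u\<in>vals K v. a u) = (\<integral>\<^sup>+y. (\<Sum>u\<in>vals K v. ennreal (g y u) * indicator C y) \<partial>M)"
    unfolding a_def using gu C by (intro nn_integral_sum[symmetric]) auto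
  also have "\<dots> = (\<integral>\<^sup>+y. indicator C y \<partial>M)"
  proof (rule nn_integral_cong)
    fix y assume y: "y \<in> space M"
    show "(\<Sum>u\<in>vals K v. ennreal (g y u) * indicator C y) = indicator C y"
    proof (cases "y \<in> C")
      case True
      have "(\<Sum>u\<in>I. g y u) = (\<Sum>u\<in>I. y u)"
        using I by (intro sum.cong) (auto simp: g_def)
      then have "(\<Sum>u\<in>vals K v. g y u) = 1"
        using I unfolding vals by (simp add: g_def)
      moreover have "\<And>u. u \<in> vals K v \<Longrightarrow> 0 \<le> g y u"
        using True C_iff[OF y] vals by (auto simp: g_def)
      ultimately show ?thesis using True by (simp add: sum_ennreal)
    qed auto
  qed
  also have "\<dots> = emeasure M C" using C by simp
  finally have sum: "(\<Sum>u\<in>vals K v. a u) = emeasure M C" .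
  have "a u = a (v K)" if "u \<in> vals K v" for u using that a_eq vals by auto
  then have "of_nat K * a w = emeasure M C"
    using sum card_vals[OF mono] w by simp
  then have K_a: "ennreal K * a w = emeasure M C" by (simp add: ennreal_of_nat_eq_real_of_nat)
  have "a w / emeasure M C = ennreal (1 / K)"
  proof -
    have "a w = ennreal (1 / K) * (ennreal K * a w)"
      using K by (simp add: mult.assoc[symmetric] ennreal_mult[symmetric])
    then have "a w = ennreal (1 / K) * emeasure M C" using K_a by simp
    \<comment> \<open>Cancelling the volume in \<open>ennreal\<close> requires it to be neither 0
      nor infinite.\<close>
    then show ?thesis using C0
      by (simp add: ennreal_times_divide[symmetric] less_top)
  qed
  moreover have "(\<integral>\<^sup>+x. ennreal (x w) \<partial>unif_markets K v) = a w / emeasure M C"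
  proof -
    have "unif_markets K v = distr (uniform_measure M C) (market_space K v) g"
      by (simp add: unif_markets_def g_def[abs_def] M_def C_def I_def)
    then have "(\<integral>\<^sup>+x. ennreal (x w) \<partial>unif_markets K v) = (\<integral>\<^sup>+y. ennreal (g y w) \<partial>uniform_measure M C)"
      using gM measurable_market_coordinate[OF w] by (simp add: nn_integral_distr)
    also have "\<dots> = a w / emeasure M C"
      unfolding a_def using gu[OF w] C by (subst nn_integral_uniform_measure) auto
    finally show ?thesis .
  qed
  ultimately show ?thesis by simp
qed

text \<open>The uniform measure is concentrated on the corner simplex, where the bound on the sum
  makes the eliminated coordinate nonnegative too. This lets the nonnegative integrals above be read
  as expectations of real functions.\<close>

lemma AE_unif_markets_nonneg:
  assumes K: "K \<ge> 1" and w: "w \<in> vals K v"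
  shows "AE x in unif_markets K v. 0 \<le> x w"
proof -
  let ?M = "PiM (vals K v - {v K}) (\<lambda>_. lborel :: real measure)"
  note comp = measurable_market_coordinate[OF w]
  have meas: "{x \<in> space (market_space K v). 0 \<le> x w} \<in> sets (market_space K v)"
    using comp by (intro borel_measurable_le) auto
  have "AE y in uniform_measure ?M (corner_simplex K v). y \<in> corner_simplex K v"
    using corner_simplex_sets by (intro AE_uniform_measureI) auto
  then have "AE y in uniform_measure ?M (corner_simplex K v).
      0 \<le> (y(v K := 1 - (\<Sum>u\<in>vals K v - {v K}. y u))) w"
    by eventually_elim (use w in \<open>auto simp: corner_simplex_def\<close>)
  then show ?thesis
    unfolding unif_markets_def
    using chart_measurable[OF K, of v] meas
    by (subst AE_distr_iff) (auto simp: measurable_def)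
qed

section \<open>The posterior and the price regions\<close>

text \<open>The mixture is first evaluated for nonnegative integrals, where measurability is enough.
  Almost sure nonnegativity and a finite value then give integrability and the real expectation
  together.\<close>

lemma has_bochner_integral_posterior_coordinate:
  assumes K: "K \<ge> 1" and mono: "strict_mono_on {1..K} v" and w: "w \<in> vals K v"
    and \<beta>: "0 \<le> \<beta>" "\<beta> \<le> 1" and xh: "xh \<in> markets K v"
  shows "has_bochner_integral (posterior K v \<beta> xh) (\<lambda>x. x w) ((1 - \<beta>) * xh w + \<beta> / K)"
proof -
  let ?N = "\<lambda>b. if b then unif_markets K v else return (market_space K v) xh"
  note comp = measurable_market_coordinate[OF w]
  have sp: "xh \<in> space (market_space K v)" and pos: "0 \<le> xh w"
    using xh w by (auto simp: markets_def space_market_space PiE_def)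
  have N: "?N \<in> measure_pmf (bernoulli_pmf \<beta>) \<rightarrow>\<^sub>M subprob_algebra (market_space K v)"
    using prob_space_unif_markets[OF K] prob_space_return[OF sp]
    by (auto simp: measurable_def space_subprob_algebra prob_space_imp_subprob_space)
  have sets: "sets (posterior K v \<beta> xh) = sets (market_space K v)"
    unfolding posterior_def by (rule sets_bind) auto
  have bind: "(\<integral>\<^sup>+x. h x \<partial>posterior K v \<beta> xh) =
      ennreal \<beta> * (\<integral>\<^sup>+x. h x \<partial>unif_markets K v) + ennreal (1 - \<beta>) * h xh"
    if "h \<in> borel_measurable (market_space K v)" for h
  proof -
    have "(\<integral>\<^sup>+x. h x \<partial>posterior K v \<beta> xh) =
        (\<integral>\<^sup>+b. (\<integral>\<^sup>+x. h x \<partial>?N b) \<partial>measure_pmf (bernoulli_pmf \<beta>))"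
      unfolding posterior_def using that N by (rule nn_integral_bind)
    also have "\<dots> = ennreal \<beta> * (\<integral>\<^sup>+x. h x \<partial>unif_markets K v) + ennreal (1 - \<beta>) * h xh"
      using \<beta> that sp by (subst nn_integral_measure_pmf_support[where A = UNIV])
        (auto simp: UNIV_bool nn_integral_return mult.commute)
    finally show ?thesis .
  qed
  show ?thesis
  proof (rule has_bochner_integral_nn_integral)
    show m: "(\<lambda>x. x w) \<in> borel_measurable (posterior K v \<beta> xh)"
      using comp by (simp add: measurable_cong_sets[OF sets])
    \<comment> \<open>Since \<open>ennreal\<close> sends negative reals to 0, this is the integral
      of the negative part; its vanishing under the posterior means \<open>0 \<le> x w\<close>
      almost everywhere.\<close>
    have "(\<integral>\<^sup>+x. ennreal (- x w) \<partial>unif_markets K v) = (\<integral>\<^sup>+x. 0 \<partial>unif_markets K v)"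
      using AE_unif_markets_nonneg[OF K w] by (intro nn_integral_cong_AE) (auto simp: ennreal_neg)
    then have "(\<integral>\<^sup>+x. ennreal (- x w) \<partial>posterior K v \<beta> xh) = 0"
      using comp pos by (subst bind) (auto simp: ennreal_neg)
    then show "AE x in posterior K v \<beta> xh. 0 \<le> x w"
      using m by (subst (asm) nn_integral_0_iff_AE) (auto simp: ennreal_eq_0_iff)
    show "0 \<le> (1 - \<beta>) * xh w + \<beta> / K" using \<beta> pos by simp
    show "(\<integral>\<^sup>+x. ennreal (x w) \<partial>posterior K v \<beta> xh) = ennreal ((1 - \<beta>) * xh w + \<beta> / K)"
    proof -
      have "(\<integral>\<^sup>+x. ennreal (x w) \<partial>posterior K v \<beta> xh) =
          ennreal \<beta> * ennreal (1 / K) + ennreal (1 - \<beta>) * ennreal (xh w)"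
        using comp by (subst bind) (simp_all add: nn_integral_unif_markets_coordinate[OF K mono w])
      also have "\<dots> = ennreal (\<beta> * (1 / K) + (1 - \<beta>) * xh w)"
        using \<beta> pos by (subst ennreal_plus) (simp_all add: ennreal_mult'[symmetric])
      finally show ?thesis by (simp add: add.commute)
    qed
  qed
qed

text \<open>For increasing \<open>v\<close> this is the survival function of the market. At
  \<open>j = K + 1\<close> the sum is empty, which supplies the boundary value 0.\<close>

definition tail :: "nat \<Rightarrow> (nat \<Rightarrow> real) \<Rightarrow> (real \<Rightarrow> real) \<Rightarrow> nat \<Rightarrow> real" where
  "tail K v x j = (\<Sum>k=j..K. x (v k))"

lemma sum_of_bool_le:
  fixes f :: "nat \<Rightarrow> real"
  assumes mono: "strict_mono_on {1..K} v" and i: "i \<in> {1..K}"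
  shows "(\<Sum>k=1..K. f k * of_bool (v i \<le> (v k :: real))) = (\<Sum>k=i..K. f k)"
proof -
  have "(\<Sum>k=1..K. f k * of_bool (v i \<le> v k)) = (\<Sum>k=1..K. if k \<in> {i..K} then f k else 0)"
    using i strict_mono_on_less_eq[OF mono i] by (intro sum.cong) auto
  also have "\<dots> = (\<Sum>k\<in>{1..K} \<inter> {i..K}. f k)" by (rule sum.inter_restrict[symmetric]) simp
  also have "{1..K} \<inter> {i..K} = {i..K}" using i by auto
  finally show ?thesis .
qed

lemma producer_util_eq_tail:
  assumes "strict_mono_on {1..K} v" "i \<in> {1..K}"
  shows "producer_util K v (v i) x = v i * tail K v x i"
  unfolding producer_util_def tail_def using sum_of_bool_le[OF assms, of "\<lambda>k. x (v k)"] by simp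

text \<open>Linearity of expectation: the tail from \<open>i\<close> has \<open>K + 1 - i\<close>
  coordinates, and the uniform component adds \<open>\<beta> / K\<close> to the mean of
  each.\<close>

lemma expected_producer_util_eq:
  assumes K: "K \<ge> 1" and mono: "strict_mono_on {1..K} v" and i: "i \<in> {1..K}"
    and \<beta>: "0 \<le> \<beta>" "\<beta> \<le> 1" and xh: "xh \<in> markets K v"
  shows "expected_producer_util K v \<beta> (v i) xh =
    v i * ((1 - \<beta>) * tail K v xh i + \<beta> / K * (real K + 1 - real i))"
proof -
  have int: "has_bochner_integral (posterior K v \<beta> xh) (\<lambda>x. v i * (\<Sum>k=i..K. x (v k)))
      (v i * (\<Sum>k=i..K. (1 - \<beta>) * xh (v k) + \<beta> / K))"
    using i by (intro has_bochner_integral_mult_right has_bochner_integral_sum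
        has_bochner_integral_posterior_coordinate[OF K mono _ \<beta> xh]) (auto simp: vals_def)
  have eq: "(\<Sum>k=i..K. (1 - \<beta>) * xh (v k) + \<beta> / K) =
      (1 - \<beta>) * tail K v xh i + \<beta> / K * (real K + 1 - real i)"
    using i by (simp add: sum.distrib sum_distrib_left tail_def of_nat_diff)
  show ?thesis
    unfolding expected_producer_util_def producer_util_eq_tail[OF mono i]
    using has_bochner_integral_integral_eq[OF int] unfolding eq by (simp only: tail_def)
qed

text \<open>The difference of two expected utilities is \<open>1 - \<beta>\<close> times the
  difference of the two sides below, and \<open>\<beta> < 1\<close> makes that factor positive. The
  result is constraint (b) for a row of total mass 1.\<close>

lemma price_region_iff:
  assumes K: "K \<ge> 1" and mono: "strict_mono_on {1..K} v" and i: "i \<in> {1..K}"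
    and \<beta>: "0 \<le> \<beta>" "\<beta> < 1"
  shows "x \<in> price_region K v \<beta> i \<longleftrightarrow> x \<in> markets K v \<and>
    (\<forall>j\<in>{1..K}. tail K v x i * v i - tail K v x j * v j \<ge>
      \<beta> / (real K * (1 - \<beta>)) * ((real K + 1 - real j) * v j - (real K + 1 - real i) * v i))"
proof -
  have "expected_producer_util K v \<beta> (v j) x \<le> expected_producer_util K v \<beta> (v i) x \<longleftrightarrow>
      \<beta> / (real K * (1 - \<beta>)) * ((real K + 1 - real j) * v j - (real K + 1 - real i) * v i)
        \<le> tail K v x i * v i - tail K v x j * v j"
    if x: "x \<in> markets K v" and j: "j \<in> {1..K}" for j
  proof -
    let ?D = "(real K + 1 - real j) * v j - (real K + 1 - real i) * v i"
    let ?T = "tail K v x i * v i - tail K v x j * v j"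
    \<comment> \<open>Naming the quotient lets the expansion treat it as an atom; the next equation
      then exposes the common factor \<open>1 - \<beta>\<close>.\<close>
    define c where "c = \<beta> / K"
    have c: "c = (1 - \<beta>) * (\<beta> / (real K * (1 - \<beta>)))"
      using \<beta> by (simp add: c_def)
    have "expected_producer_util K v \<beta> (v i) x - expected_producer_util K v \<beta> (v j) x =
        (1 - \<beta>) * ?T - \<beta> / K * ?D"
      unfolding expected_producer_util_eq[OF K mono i \<beta>(1) less_imp_le[OF \<beta>(2)] x]
        expected_producer_util_eq[OF K mono j \<beta>(1) less_imp_le[OF \<beta>(2)] x]
      unfolding c_def[symmetric] by (simp add: algebra_simps)
    also have "\<dots> = (1 - \<beta>) * (?T - \<beta> / (real K * (1 - \<beta>)) * ?D)"
      unfolding c_def[symmetric] c by (simp only: right_diff_distrib mult.assoc)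
    finally have "expected_producer_util K v \<beta> (v j) x \<le> expected_producer_util K v \<beta> (v i) x \<longleftrightarrow>
        0 \<le> (1 - \<beta>) * (?T - \<beta> / (real K * (1 - \<beta>)) * ?D)"
      by linarith
    also have "\<dots> \<longleftrightarrow> 0 \<le> ?T - \<beta> / (real K * (1 - \<beta>)) * ?D"
      using \<beta> by (simp only: zero_le_mult_iff) auto
    finally show ?thesis by linarith
  qed
  then show ?thesis by (auto simp: price_region_def)
qed

section \<open>Weighted tails as coordinates\<close>

text \<open>Summation by parts, as an induction that lowers the price. Going from
  \<open>v (Suc n)\<close> to \<open>v n\<close> saves every buyer in the tail from
  \<open>Suc n\<close> the difference of the prices, while buyers of value \<open>v n\<close> gain
  nothing.\<close>

lemma consumer_util_eq_tail:
  assumes mono: "strict_mono_on {1..K} v" and i: "i \<in> {1..K}"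
  shows "consumer_util K v (v i) x = (\<Sum>j=i+1..K. (v j - v (j - 1)) * tail K v x j)"
proof -
  have "consumer_util K v (v i) x = (\<Sum>k=i..K. x (v k) * (v k - v i))"
    unfolding consumer_util_def by (rule sum_of_bool_le[OF mono i])
  also have "\<dots> = (\<Sum>j=i+1..K. (v j - v (j - 1)) * tail K v x j)"
  proof -
    have "i \<le> K" using i by simp
    then show ?thesis
    proof (induction i rule: inc_induct)
      case base
      then show ?case by simp
    next
      case (step n)
      have "(\<Sum>k=n..K. x (v k) * (v k - v n)) = (\<Sum>k=Suc n..K. x (v k) * (v k - v n))"
        using step.hyps by (subst sum.atLeast_Suc_atMost) auto
      also have "\<dots> = (\<Sum>k=Suc n..K. x (v k) * (v k - v (Suc n)) + (v (Suc n) - v n) * x (v k))"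
        by (intro sum.cong) (auto simp: algebra_simps)
      also have "\<dots> = (\<Sum>j=Suc n + 1..K. (v j - v (j - 1)) * tail K v x j)
          + (v (Suc n) - v n) * tail K v x (Suc n)"
        by (simp add: sum.distrib step.IH tail_def sum_distrib_left)
      also have "\<dots> = (\<Sum>j=n+1..K. (v j - v (j - 1)) * tail K v x j)"
        using step.hyps by (subst (2) sum.atLeast_Suc_atMost) (auto simp: add.commute)
      finally show ?case .
    qed
  qed
  finally show ?thesis .
qed

text \<open>Serves both inclusions: once the entries of \<open>z\<close> are weighted tails, the two
  surpluses match, and only the constraints remain to be compared.\<close>

lemma surplus_map_tails:
  assumes K: "K \<ge> 1" and mono: "strict_mono_on {1..K} v"
    and z: "\<And>i j. i \<in> {1..K} \<Longrightarrow> j \<in> {1..K} \<Longrightarrow> z (i, j) = \<gamma> i * tail K v (x i) j"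
  shows "surplus_map K v z =
    vector [\<Sum>k=1..K. \<gamma> k * consumer_util K v (v k) (x k),
            \<Sum>k=1..K. \<gamma> k * producer_util K v (v k) (x k)]"
proof -
  have "(\<Sum>i=1..K. v i * z (i, i)) = (\<Sum>k=1..K. \<gamma> k * producer_util K v (v k) (x k))"
    using producer_util_eq_tail[OF mono] z by (intro sum.cong) auto
  \<comment> \<open>Row \<open>K\<close> may be added because its inner sum is empty.\<close>
  moreover have "(\<Sum>i=1..K - 1. \<Sum>j=i + 1..K. (v j - v (j - 1)) * z (i, j)) =
      (\<Sum>i=1..K. \<Sum>j=i + 1..K. (v j - v (j - 1)) * z (i, j))"
    using K by (intro sum.mono_neutral_left) auto
  moreover have "\<dots> = (\<Sum>k=1..K. \<gamma> k * consumer_util K v (v k) (x k))"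
  proof (rule sum.cong)
    fix i assume "i \<in> {1..K}"
    then show "(\<Sum>j=i + 1..K. (v j - v (j - 1)) * z (i, j)) = \<gamma> i * consumer_util K v (v i) (x i)"
      using consumer_util_eq_tail[OF mono, of i "x i"] z
      by (auto simp: sum_distrib_left intro!: sum.cong)
  qed simp
  ultimately show ?thesis by (simp add: surplus_map_def)
qed

section \<open>The two inclusions, and linearity of the map\<close>

lemma sum_vals:
  assumes "strict_mono_on {1..K} v"
  shows "(\<Sum>w\<in>vals K v. x w) = tail K v x 1"
  unfolding vals_def tail_def using strict_mono_on_imp_inj_on[OF assms]
  by (simp add: sum.reindex)

lemma surplus_set_subset:
  assumes K: "K \<ge> 1" and mono: "strict_mono_on {1..K} v" and \<beta>: "0 \<le> \<beta>" "\<beta> < 1"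
  shows "surplus_set K v \<beta> xs \<subseteq> surplus_map K v ` surplus_polytope K v \<beta> xs"
proof
  fix s assume "s \<in> surplus_set K v \<beta> xs"
  then obtain \<gamma> x where s: "s = vector [\<Sum>k=1..K. \<gamma> k * consumer_util K v (v k) (x k),
            \<Sum>k=1..K. \<gamma> k * producer_util K v (v k) (x k)]"
    and \<gamma>: "\<And>k. k \<in> {1..K} \<Longrightarrow> \<gamma> k \<ge> 0"
    and avg: "\<And>w. w \<in> vals K v \<Longrightarrow> (\<Sum>k=1..K. \<gamma> k * x k w) = xs w"
    and reg: "\<And>k. k \<in> {1..K} \<Longrightarrow> \<gamma> k > 0 \<Longrightarrow> x k \<in> price_region K v \<beta> k"
    unfolding surplus_set_def by force
  define z where "z = (\<lambda>(i, j). if i \<in> {1..K} \<and> j \<in> {1..K} then \<gamma> i * tail K v (x i) j else 0)"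
  have z: "z (i, j) = \<gamma> i * tail K v (x i) j" if "i \<in> {1..K}" "j \<in> {1..K}" for i j
    using that by (simp add: z_def)
  \<comment> \<open>Only the product is known to be nonnegative: where
    \<open>\<gamma> i = 0\<close>, the function \<open>x i\<close> is arbitrary and may take
    negative values.\<close>
  have pos: "0 \<le> \<gamma> i * x i (v k)" if "i \<in> {1..K}" "k \<in> {1..K}" for i k
  proof (cases "\<gamma> i > 0")
    case True
    then have "x i \<in> markets K v" using reg[OF that(1)] by (simp add: price_region_def)
    then show ?thesis using True that by (auto simp: markets_def vals_def PiE_def Pi_def)
  qed (use \<gamma>[OF that(1)] in simp)
  have "z \<in> surplus_polytope K v \<beta> xs"
    unfolding surplus_polytope_def mem_Collect_eq
  proof (intro conjI ballI)
    show "z \<in> arrays K" by (auto simp: arrays_def z_def)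
  next
    fix i j assume i: "i \<in> {1..K}" and j: "j \<in> {1..<K}"
    have "tail K v (x i) j = x i (v j) + tail K v (x i) (j + 1)"
      using j unfolding tail_def by (subst sum.atLeast_Suc_atMost) auto
    then show "z (i, j + 1) \<le> z (i, j)"
      using z[OF i, of j] z[OF i, of "j + 1"] i j pos[OF i, of j] by (auto simp: distrib_left)
  next
    fix i assume i: "i \<in> {1..K}"
    then show "0 \<le> z (i, K)" using z[OF i, of K] pos[OF i, of K] K by (simp add: tail_def)
  next
    fix i j assume i: "i \<in> {1..K}" and j: "j \<in> {1..K}"
    have 1: "1 \<in> {1..K}" using K by simp
    let ?d = "\<beta> / (real K * (1 - \<beta>))"
    let ?D = "(real K + 1 - real j) * v j - (real K + 1 - real i) * v i"
    show "?d * z (i, 1) * ?D \<le> z (i, i) * v i - z (i, j) * v j"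
    \<comment> \<open>A positive weight equals \<open>z (i, 1)\<close> because the market has mass
      1, so (b) is the region inequality times \<open>\<gamma> i\<close>. With weight 0 the row
      vanishes and (b) reads \<open>0 \<le> 0\<close>.\<close>
    proof (cases "\<gamma> i > 0")
      case True
      from reg[OF i True] have "x i \<in> markets K v"
        and le: "?d * ?D \<le> tail K v (x i) i * v i - tail K v (x i) j * v j"
        using price_region_iff[OF K mono i \<beta>] j by auto
      then have "tail K v (x i) 1 = 1" using sum_vals[OF mono] by (simp add: markets_def)
      then have "z (i, 1) = \<gamma> i" using z[OF i 1] by simp
      then have "?d * z (i, 1) * ?D = \<gamma> i * (?d * ?D)" by simp
      also have "\<dots> \<le> \<gamma> i * (tail K v (x i) i * v i - tail K v (x i) j * v j)"
        using le True by (intro mult_left_mono) auto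
      also have "\<dots> = z (i, i) * v i - z (i, j) * v j"
        unfolding z[OF i i] z[OF i j] by (simp add: algebra_simps)
      finally show ?thesis .
    next
      case False
      then have "\<gamma> i = 0" using \<gamma>[OF i] by simp
      then show ?thesis using z[OF i 1] z[OF i i] z[OF i j] by simp
    qed
  next
    fix j assume j: "j \<in> {1..K}"
    have "(\<Sum>i=1..K. z (i, j)) = (\<Sum>i=1..K. \<Sum>k=j..K. \<gamma> i * x i (v k))"
      using j z by (intro sum.cong) (auto simp: tail_def sum_distrib_left)
    also have "\<dots> = (\<Sum>k=j..K. \<Sum>i=1..K. \<gamma> i * x i (v k))" by (rule sum.swap)
    also have "\<dots> = (\<Sum>k=j..K. xs (v k))"
      using j by (intro sum.cong avg) (auto simp: vals_def)
    finally show "(\<Sum>i=1..K. z (i, j)) = (\<Sum>k=j..K. xs (v k))" .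
  qed
  moreover have "s = surplus_map K v z" using surplus_map_tails[OF K mono z] s by simp
  ultimately show "s \<in> surplus_map K v ` surplus_polytope K v \<beta> xs" by blast
qed

text \<open>Each constraint supplies one property of the recovered segmentation: (a) nonnegative
  masses, (b) optimality of the prices, (c) total weight 1 at \<open>j = 1\<close> and, by
  differences of consecutive columns, the average \<open>xs\<close>.\<close>

lemma surplus_polytope_subset:
  assumes K: "K \<ge> 1" and mono: "strict_mono_on {1..K} v" and \<beta>: "0 \<le> \<beta>" "\<beta> < 1"
    and xs: "xs \<in> markets K v"
  shows "surplus_map K v ` surplus_polytope K v \<beta> xs \<subseteq> surplus_set K v \<beta> xs"
proof
  fix s assume "s \<in> surplus_map K v ` surplus_polytope K v \<beta> xs"
  then obtain z where s: "s = surplus_map K v z" and z: "z \<in> surplus_polytope K v \<beta> xs" by blast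
  txt \<open>Arrays vanish off the index square, so the differences below need no special case at the
    last column.\<close>
  from z have z0: "\<And>i. z (i, K + 1) = 0"
    and dec': "\<And>i j. i \<in> {1..K} \<Longrightarrow> j \<in> {1..<K} \<Longrightarrow> z (i, j + 1) \<le> z (i, j)"
    and zK: "\<And>i. i \<in> {1..K} \<Longrightarrow> 0 \<le> z (i, K)"
    and zb: "\<And>i j. i \<in> {1..K} \<Longrightarrow> j \<in> {1..K} \<Longrightarrow> \<beta> / (real K * (1 - \<beta>)) * z (i, 1) *
             ((real K + 1 - real j) * v j - (real K + 1 - real i) * v i) \<le> z (i, i) * v i - z (i, j) * v j"
    and zc: "\<And>j. j \<in> {1..K} \<Longrightarrow> (\<Sum>i=1..K. z (i, j)) = tail K v xs j"
    by (auto simp: surplus_polytope_def arrays_def tail_def)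
  have dec: "z (i, j + 1) \<le> z (i, j)" if "i \<in> {1..K}" "j \<in> {1..K}" for i j
    using that dec'[of i j] zK z0 by (cases "j = K") auto
  have antimono: "z (i, k) \<le> z (i, j)" if i: "i \<in> {1..K}" and "1 \<le> j" "j \<le> k" "k \<le> K" for i j k
    using \<open>j \<le> k\<close> \<open>k \<le> K\<close>
  proof (induction k rule: dec_induct)
    case (step n)
    then show ?case using dec[OF i, of n] \<open>1 \<le> j\<close> by simp
  qed simp
  have nonneg: "0 \<le> z (i, j)" and le1: "z (i, j) \<le> z (i, 1)"
    if "i \<in> {1..K}" "j \<in> {1..K}" for i j
    using antimono[OF that(1), of j K] antimono[OF that(1), of 1 j] zK[OF that(1)] that(2) by auto
  define \<gamma> where "\<gamma> i = z (i, 1)" for i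
  \<comment> \<open>Markets are functions of the value, so the column index has to be recovered from
    it; \<open>restrict\<close> below provides the extensionality that \<open>markets\<close>
    demands.\<close>
  define ix where "ix = the_inv_into {1..K} v"
  define x where "x i = restrict (\<lambda>w. (z (i, ix w) - z (i, ix w + 1)) / \<gamma> i) (vals K v)" for i
  have x: "x i (v k) = (z (i, k) - z (i, k + 1)) / \<gamma> i" if "k \<in> {1..K}" for i k
    using that the_inv_into_f_f[OF strict_mono_on_imp_inj_on[OF mono]]
    by (auto simp: x_def ix_def vals_def)
  have 1: "1 \<in> {1..K}" using K by simp
  have \<gamma>0: "0 \<le> \<gamma> i" if "i \<in> {1..K}" for i using nonneg[OF that 1] by (simp add: \<gamma>_def)
  have \<gamma>x: "\<gamma> i * x i (v k) = z (i, k) - z (i, k + 1)" if i: "i \<in> {1..K}" and k: "k \<in> {1..K}" for i k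
  \<comment> \<open>Division by 0 yields 0, so for \<open>\<gamma> i = 0\<close> the function
    \<open>x i\<close> is no market. The identity survives because the row lies between 0 and its
    first entry, which is 0.\<close>
  proof (cases "\<gamma> i = 0")
    case True
    then have zero: "z (i, j) = 0" if "j \<in> {1..K}" for j
      using nonneg[OF i that] le1[OF i that] by (simp add: \<gamma>_def)
    then have "z (i, k + 1) = 0" using z0 k by (cases "k = K") auto
    then show ?thesis using True zero[OF k] by simp
  qed (use x[OF k] in simp)
  have \<gamma>tail: "\<gamma> i * tail K v (x i) j = z (i, j)" if i: "i \<in> {1..K}" and j: "j \<in> {1..K}" for i j
  proof -
    have "\<gamma> i * tail K v (x i) j = (\<Sum>k=j..K. z (i, k) - z (i, Suc k))"
      unfolding tail_def sum_distrib_left using \<gamma>x[OF i] j by (intro sum.cong) auto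
    also have "\<dots> = z (i, j) - z (i, K + 1)"
      \<comment> \<open>The telescoping rule subtracts the earlier term from the later one, hence
        the negated row.\<close>
      using j sum_Suc_diff[of j K "\<lambda>k. - z (i, k)"] by simp
    finally show ?thesis using z0 by simp
  qed
  have \<gamma>sum: "(\<Sum>k=1..K. \<gamma> k) = 1"
    using zc[OF 1] sum_vals[OF mono, of xs] xs by (simp add: \<gamma>_def markets_def)
  have "\<gamma> k \<in> {0..1}" if k: "k \<in> {1..K}" for k
  proof -
    have "\<gamma> k \<le> (\<Sum>k=1..K. \<gamma> k)" using k \<gamma>0 by (intro member_le_sum) auto
    then show ?thesis using \<gamma>sum \<gamma>0[OF k] by simp
  qed
  moreover have "(\<Sum>i=1..K. \<gamma> i * x i w) = xs w" if "w \<in> vals K v" for w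
  proof -
    from that obtain k where k: "k \<in> {1..K}" "w = v k" by (auto simp: vals_def)
    have "(\<Sum>i=1..K. \<gamma> i * x i w) = (\<Sum>i=1..K. z (i, k)) - (\<Sum>i=1..K. z (i, k + 1))"
      unfolding k(2) sum_subtractf[symmetric] using \<gamma>x k(1) by (intro sum.cong) auto
    also have "(\<Sum>i=1..K. z (i, k + 1)) = tail K v xs (k + 1)"
      \<comment> \<open>Constraint (c) stops at column \<open>K\<close>; one column further both
        sides are 0.\<close>
      using zc[of "k + 1"] z0 k(1) by (cases "k = K") (auto simp: tail_def)
    also have "(\<Sum>i=1..K. z (i, k)) = xs (v k) + tail K v xs (k + 1)"
      unfolding zc[OF k(1)] using k(1) unfolding tail_def by (subst sum.atLeast_Suc_atMost) auto
    finally show ?thesis using k by simp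
  qed
  moreover have "x i \<in> price_region K v \<beta> i" if i: "i \<in> {1..K}" and "\<gamma> i > 0" for i
    unfolding price_region_iff[OF K mono i \<beta>]
  proof (intro conjI ballI)
    have tail1: "tail K v (x i) 1 = 1"
      using \<gamma>tail[OF i 1] \<open>\<gamma> i > 0\<close> by (simp add: \<gamma>_def)
    have "0 \<le> x i (v k)" if "k \<in> {1..K}" for k
      using dec[OF i that] \<gamma>0[OF i] by (simp add: x[OF that])
    then show "x i \<in> markets K v"
      using tail1 sum_vals[OF mono, of "x i"] by (auto simp: markets_def x_def vals_def)
  next
    fix j assume j: "j \<in> {1..K}"
    let ?d = "\<beta> / (real K * (1 - \<beta>))"
    let ?D = "(real K + 1 - real j) * v j - (real K + 1 - real i) * v i"
    have "\<gamma> i * (?d * ?D) = ?d * z (i, 1) * ?D" by (simp add: \<gamma>_def)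
    also have "\<dots> \<le> z (i, i) * v i - z (i, j) * v j" using zb[OF i j] .
    also have "\<dots> = \<gamma> i * (tail K v (x i) i * v i - tail K v (x i) j * v j)"
      unfolding \<gamma>tail[OF i i, symmetric] \<gamma>tail[OF i j, symmetric] by (simp add: algebra_simps)
    finally show "?d * ?D \<le> tail K v (x i) i * v i - tail K v (x i) j * v j"
      using \<open>\<gamma> i > 0\<close> by (simp only: mult_le_cancel_left_pos)
  qed
  moreover have "s = vector [\<Sum>k=1..K. \<gamma> k * consumer_util K v (v k) (x k),
            \<Sum>k=1..K. \<gamma> k * producer_util K v (v k) (x k)]"
    unfolding s using \<gamma>tail by (intro surplus_map_tails[OF K mono]) simp
  ultimately show "s \<in> surplus_set K v \<beta> xs"
    unfolding surplus_set_def using \<gamma>sum by blast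
qed

text \<open>Linearity is taken on all functions on index pairs with pointwise scaling. It restricts
  to \<open>arrays K\<close>, the copy of the array space that contains the polytope.\<close>

lemma linear_surplus_map: "Vector_Spaces.linear (\<lambda>c z ij. c * z ij) (*\<^sub>R) (surplus_map K v)"
proof -
  have "vector_space (\<lambda>c (z :: nat \<times> nat \<Rightarrow> real) ij. c * z ij)"
    by unfold_locales (auto simp: fun_eq_iff algebra_simps)
  moreover have "vector_space ((*\<^sub>R) :: real \<Rightarrow> real ^ 2 \<Rightarrow> real ^ 2)"
    by unfold_locales (auto simp: algebra_simps)
  moreover have "surplus_map K v (y + z) = surplus_map K v y + surplus_map K v z" for y z
    by (simp add: surplus_map_def vec_eq_iff forall_2 distrib_left sum.distrib)
  moreover have "surplus_map K v (\<lambda>ij. c * z ij) = c *\<^sub>R surplus_map K v z" for c z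
    by (simp add: surplus_map_def vec_eq_iff forall_2 sum_distrib_left mult.left_commute)
  ultimately show ?thesis by (simp add: Vector_Spaces.linear_iff)
qed

theorem theorem2:
  fixes K :: nat and v :: "nat \<Rightarrow> real" and xs :: "real \<Rightarrow> real" and \<beta> :: real
  assumes "K \<ge> 2"
    and "0 < v 1"
    and "strict_mono_on {1..K} v"
    and "xs \<in> markets K v"
    and "0 \<le> \<beta>" and "\<beta> < 1"
  shows "Vector_Spaces.linear (\<lambda>c z ij. c * z ij) (*\<^sub>R) (surplus_map K v) \<and>
    surplus_set K v \<beta> xs = surplus_map K v ` surplus_polytope K v \<beta> xs"
proof -
  have "K \<ge> 1" using assms(1) by simp
  then show ?thesis
    using linear_surplus_map surplus_set_subset[of K v \<beta> xs] surplus_polytope_subset[of K v \<beta> xs] assms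
    by blast
qed

end
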